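(* For every $z\in\mathbb C$ such that $\operatorname{Re}(z)>-1$, one has $$\sum_{n=0}^\infty (-1)^n\frac{\eta_n}{n!}z^n=1-(z+1)e^{z+1}E_1(z+1).$$
   Context: For $n=0,1,2,\dots$, $\eta_n:=\int_0^{\infty}\frac{t^n}{(1+t)^2}e^{-t}\,dt$. $E_1$ is the exponential integral function $E_1(w):=\int_1^\infty \frac{e^{-wt}}{t}\,dt$ for $\operatorname{Re}(w)>0$.
   Formalization: The series diverges for |z|>1 (e.g. z=2), so the equation is proved as a convergent sum exactly for |z|≤1 with Re(z)>-1; for other z with Re(z)>-1 the sum is understood as the holomorphic continuation to Re(z)>-1 of the function the series represents near 0. *)

theory Defs
  imports "HOL-Complex_Analysis.Complex_Analysis"
begin

definition eta :: "nat \<Rightarrow> real" where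
  "eta n = (LBINT t:{0..}. t ^ n / (1 + t)\<^sup>2 * exp (- t))"

(* Meaningful for Re w > 0 only; if the integrand is not integrable, the Bochner integral is 0. *)
definition E1 :: "complex \<Rightarrow> complex" where
  "E1 w = (LBINT t:{1..}. exp (- w * of_real t) / of_real t)"

(* s is the value at z of the sum of the power series with coefficients a, where outside the disc
   of convergence the sum is understood as the holomorphic continuation to the domain D of the
   function that the series represents near 0.  The value s is unique, see below. *)
definition has_continued_sum ::
    "(nat \<Rightarrow> complex) \<Rightarrow> complex set \<Rightarrow> complex \<Rightarrow> complex \<Rightarrow> bool" where
  "has_continued_sum a D z s \<longleftrightarrow>
     open D \<and> connected D \<and> 0 \<in> D \<and> z \<in> D \<and>
     (\<exists>F. F holomorphic_on D \<and> (\<forall>\<^sub>F w in nhds 0. (\<lambda>n. a n * w ^ n) sums F w) \<and> F z = s)"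

lemma has_continued_sum_unique:
  assumes "has_continued_sum a D z s" "has_continued_sum a D z s'"
  shows "s = s'"
proof -
  from assms obtain F G where D: "open D" "connected D" "0 \<in> D" "z \<in> D"
    and F: "F holomorphic_on D" "\<forall>\<^sub>F w in nhds 0. (\<lambda>n. a n * w ^ n) sums F w" "F z = s"
    and G: "G holomorphic_on D" "\<forall>\<^sub>F w in nhds 0. (\<lambda>n. a n * w ^ n) sums G w" "G z = s'"
    unfolding has_continued_sum_def by blast
  have "\<forall>\<^sub>F w in nhds 0. F w = G w"
    using F(2) G(2) by eventually_elim (rule sums_unique2)
  then obtain U where U: "open U" "0 \<in> U" "\<And>w. w \<in> U \<Longrightarrow> F w = G w"
    unfolding eventually_nhds by blast
  have "F z = G z"
  proof (rule analytic_continuation_open[where s = "U \<inter> D" and s' = D and f = F and g = G])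
    show "U \<inter> D \<noteq> {}" using U(2) D(3) by blast
  qed (use U D F(1) G(1) in auto)
  with F(3) G(3) show ?thesis by simp
qed

end

theory Submission
  imports Defs "HOL-Probability.Distributions" "HOL-Real_Asymp.Real_Asymp"
begin

text \<open>Since \<open>eta n / fact n\<close> is the mean of \<open>1 / (1 + t)\<^sup>2\<close> under the Gamma density
  \<open>t ^ n * exp (- t) / fact n\<close>, it is of order \<open>1 / n\<^sup>2\<close>; hence the series converges exactly on the
  closed unit disc. There, summation under the integral sign gives the integral of
  \<open>exp (- (z + 1) * t) / (1 + t)\<^sup>2\<close> over the half-line. It is holomorphic for \<open>Re z > -1\<close>, being the
  uniform limit of its truncations, and one integration by parts expresses it through \<open>E1\<close>.\<close>

lemma set_integrable_inverse_square:
  fixes a :: real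
  assumes "a \<ge> 0"
  shows "set_integrable lborel {a..} (\<lambda>t. 1 / (1 + t)\<^sup>2)"
    and "(LBINT t:{a..}. 1 / (1 + t)\<^sup>2) = 1 / (1 + a)"
proof -
  have lim: "((\<lambda>t. - (1 / (1 + t))) \<longlongrightarrow> (0::real)) at_top"
    by real_asymp
  have "(\<integral>\<^sup>+t. ennreal (1 / (1 + t)\<^sup>2) * indicator {a..} t \<partial>lborel) = ennreal (0 - (- (1 / (1 + a))))"
    using assms
    by (intro nn_integral_FTC_atLeast[where F = "\<lambda>t. - (1 / (1 + t))"] lim)
       (auto intro!: derivative_eq_intros simp: power2_eq_square)
  also have "(\<integral>\<^sup>+t. ennreal (1 / (1 + t)\<^sup>2) * indicator {a..} t \<partial>lborel) =
      (\<integral>\<^sup>+t. ennreal (indicator {a..} t *\<^sub>R (1 / (1 + t)\<^sup>2)) \<partial>lborel)"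
    by (intro nn_integral_cong) (auto split: split_indicator)
  finally have nn: "(\<integral>\<^sup>+t. ennreal (indicator {a..} t *\<^sub>R (1 / (1 + t)\<^sup>2)) \<partial>lborel) = ennreal (1 / (1 + a))"
    by simp
  show "set_integrable lborel {a..} (\<lambda>t. 1 / (1 + t)\<^sup>2)"
    unfolding set_integrable_def by (rule integrableI_nn_integral_finite[OF _ _ nn]) auto
  show "(LBINT t:{a..}. 1 / (1 + t)\<^sup>2) = 1 / (1 + a)"
    unfolding set_lebesgue_integral_def using assms
    by (subst integral_eq_nn_integral) (auto simp: nn[simplified])
qed

lemma set_integrable_power_times_exp:
  shows "set_integrable lborel {0..} (\<lambda>t::real. t ^ k * exp (- t))"
    and "(LBINT t:{0..}. t ^ k * exp (- t :: real)) = fact k"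
proof -
  have "(\<integral>\<^sup>+t. ennreal (t ^ k * exp (- t)) * indicator {0..} t \<partial>lborel) =
      (\<integral>\<^sup>+t. ennreal (indicator {0..} t *\<^sub>R (t ^ k * exp (- t))) \<partial>lborel)"
    by (intro nn_integral_cong) (auto split: split_indicator)
  then have nn: "(\<integral>\<^sup>+t. ennreal (indicator {0..} t *\<^sub>R (t ^ k * exp (- t))) \<partial>lborel) = ennreal (fact k)"
    by (simp add: nn_intergal_power_times_exp_Ici flip: ennreal_of_nat_eq_real_of_nat)
  have nonneg: "AE t in lborel. 0 \<le> indicator {0..} t *\<^sub>R (t ^ k * exp (- t :: real))"
    by (auto split: split_indicator)
  show "set_integrable lborel {0..} (\<lambda>t::real. t ^ k * exp (- t))"
    unfolding set_integrable_def by (rule integrableI_nn_integral_finite[OF _ nonneg nn]) auto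
  show "(LBINT t:{0..}. t ^ k * exp (- t :: real)) = fact k"
    unfolding set_lebesgue_integral_def
    by (subst integral_eq_nn_integral[OF _ nonneg]) (use nn in auto)
qed

lemma set_integrable_eta:
  "set_integrable lborel {0..} (\<lambda>t::real. t ^ n / (1 + t)\<^sup>2 * exp (- t))"
proof (rule set_integrable_bound[OF set_integrable_power_times_exp(1)[of n]])
  show "set_borel_measurable lborel {0..} (\<lambda>t::real. t ^ n / (1 + t)\<^sup>2 * exp (- t))"
    unfolding set_borel_measurable_def by measurable
  have "t ^ n / (1 + t)\<^sup>2 * exp (- t) \<le> t ^ n * exp (- t)" if "t \<ge> 0" for t :: real
    using mult_left_mono[of 1 "(1 + t)\<^sup>2" "t ^ n"] that
    by (intro mult_right_mono) (simp_all add: divide_le_eq add_nonneg_pos one_le_power)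
  then show "AE t in lborel. t \<in> {0..} \<longrightarrow>
      norm (t ^ n / (1 + t)\<^sup>2 * exp (- t)) \<le> norm (t ^ n * exp (- t) :: real)"
    by auto
qed

lemma eta_nonneg: "eta n \<ge> 0"
  unfolding eta_def set_lebesgue_integral_def
  by (intro integral_nonneg_AE) (auto split: split_indicator)

lemma eta_le_fact: "eta (n + 2) \<le> fact n"
proof -
  have "eta (n + 2) \<le> (LBINT t:{0..}. t ^ n * exp (- t :: real))"
    unfolding eta_def
  proof (rule set_integral_mono[OF set_integrable_eta set_integrable_power_times_exp(1)])
    fix t :: real assume "t \<in> {0..}"
    then have "t ^ n * t\<^sup>2 \<le> t ^ n * (1 + t)\<^sup>2"
      by (intro mult_left_mono power_mono) auto
    then have "t ^ (n + 2) / (1 + t)\<^sup>2 \<le> t ^ n"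
      using \<open>t \<in> {0..}\<close> by (simp add: divide_le_eq power_add del: power_Suc add_2_eq_Suc')
    then show "t ^ (n + 2) / (1 + t)\<^sup>2 * exp (- t) \<le> t ^ n * exp (- t)"
      by (rule mult_right_mono) simp
  qed
  then show ?thesis
    by (simp add: set_integrable_power_times_exp(2))
qed

text \<open>Jensen's inequality for the Gamma density \<open>t ^ n * exp (- t) / fact n\<close>, whose mean is \<open>n + 1\<close>:
  integrate the tangent of \<open>1 / u\<^sup>2\<close> at \<open>u = n + 2\<close>.\<close>

lemma eta_ge: "eta n \<ge> fact n / (real n + 2)\<^sup>2"
proof -
  define m where "m = real n + 2"
  have m: "m > 0" by (simp add: m_def)
  let ?p = "\<lambda>t::real. (3 / m\<^sup>2 - 2 / m ^ 3) * (t ^ n * exp (- t)) - 2 / m ^ 3 * (t ^ (n + 1) * exp (- t))"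
  have tangent: "3 / m\<^sup>2 - 2 * u / m ^ 3 \<le> 1 / u\<^sup>2" if "u > 0" for u :: real
  proof -
    have "m ^ 3 - (3 * m - 2 * u) * u\<^sup>2 = (m - u)\<^sup>2 * (m + 2 * u)"
      by (simp add: algebra_simps power2_eq_square power3_eq_cube)
    also have "\<dots> \<ge> 0"
      using m that by simp
    finally have "(3 * m - 2 * u) * u\<^sup>2 \<le> m ^ 3" by simp
    moreover have "3 / m\<^sup>2 - 2 * u / m ^ 3 = (3 * m - 2 * u) / m ^ 3"
      using m by (simp add: field_simps power2_eq_square power3_eq_cube)
    ultimately show ?thesis
      using m that by (simp add: divide_le_eq le_divide_eq)
  qed
  have int: "set_integrable lborel {0..} ?p"
    by (intro set_integral_diff set_integrable_mult_right set_integrable_power_times_exp)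
  have "(LBINT t:{0..}. ?p t) = (3 / m\<^sup>2 - 2 / m ^ 3) * fact n - 2 / m ^ 3 * fact (n + 1)"
    by (subst set_integral_diff)
       (simp_all only: set_integral_mult_right set_integrable_power_times_exp set_integrable_mult_right)
  also have "\<dots> = fact n * (3 / m\<^sup>2 - 2 * (real n + 2) / m ^ 3)"
    by (simp add: algebra_simps add_divide_distrib)
  also have "\<dots> = fact n / m\<^sup>2"
    unfolding m_def[symmetric] using m by (simp add: field_simps power2_eq_square power3_eq_cube)
  finally have "fact n / m\<^sup>2 = (LBINT t:{0..}. ?p t)" ..
  also have "\<dots> \<le> eta n"
    unfolding eta_def
  proof (rule set_integral_mono[OF int set_integrable_eta])
    fix t :: real assume "t \<in> {0..}"
    then have "t ^ n * exp (- t) * (3 / m\<^sup>2 - 2 * (1 + t) / m ^ 3) \<le> t ^ n * exp (- t) * (1 / (1 + t)\<^sup>2)"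
      by (intro mult_left_mono tangent) auto
    then show "?p t \<le> t ^ n / (1 + t)\<^sup>2 * exp (- t)"
      by (simp add: algebra_simps add_divide_distrib)
  qed
  finally show ?thesis by (simp add: m_def)
qed

lemma summable_eta: "summable (\<lambda>n. eta n / fact n)"
proof -
  have "summable (\<lambda>n. eta (n + 2) / fact (n + 2))"
  proof (rule summable_comparison_test)
    show "summable (\<lambda>n. inverse (real (n + 1) ^ 2))"
      using inverse_power_summable[of 2, where ?'a = real]
        summable_Suc_iff[of "\<lambda>n. inverse (real n ^ 2)"] by simp
    have "norm (eta (n + 2) / fact (n + 2)) \<le> inverse (real (n + 1) ^ 2)" for n
    proof -
      have "norm (eta (n + 2) / fact (n + 2)) = eta (n + 2) / fact (n + 2)"
        using eta_nonneg by simp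
      also have "\<dots> \<le> fact n / fact (n + 2)"
        by (intro divide_right_mono eta_le_fact) simp
      also have "\<dots> = 1 / ((real n + 2) * (real n + 1))"
        by (simp add: divide_simps) (simp add: algebra_simps)
      also have "\<dots> \<le> 1 / ((real n + 1) * (real n + 1))"
        by (intro divide_left_mono mult_mono) auto
      also have "\<dots> = inverse (real (n + 1) ^ 2)"
        by (simp add: power2_eq_square divide_inverse add.commute)
      finally show ?thesis .
    qed
    then show "\<exists>N. \<forall>n\<ge>N. norm (eta (n + 2) / fact (n + 2)) \<le> inverse (real (n + 1) ^ 2)"
      by blast
  qed
  then show ?thesis
    by (rule summable_iff_shift[THEN iffD1])
qed

lemma not_summable_eta_power:
  fixes z :: complex
  assumes "norm z > 1"
  shows "\<not> summable (\<lambda>n. (-1) ^ n * of_real (eta n / fact n) * z ^ n)"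
proof
  assume "summable (\<lambda>n. (-1) ^ n * of_real (eta n / fact n) * z ^ n)"
  then have lim: "(\<lambda>n. norm ((-1) ^ n * of_real (eta n / fact n) * z ^ n)) \<longlonglongrightarrow> 0"
    by (intro tendsto_norm_zero summable_LIMSEQ_zero)
  have le: "norm z ^ n / (real n + 2)\<^sup>2 \<le> norm ((-1) ^ n * of_real (eta n / fact n) * z ^ n)" for n
  proof -
    have "1 / (real n + 2)\<^sup>2 \<le> eta n / fact n"
      using divide_right_mono[OF eta_ge[of n], of "fact n"] by simp
    then have "norm z ^ n * (1 / (real n + 2)\<^sup>2) \<le> norm z ^ n * (eta n / fact n)"
      by (intro mult_left_mono) auto
    then show ?thesis
      using eta_nonneg[of n] by (simp add: norm_mult norm_power norm_divide mult.commute)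
  qed
  have "(\<lambda>n. norm z ^ n / (real n + 2)\<^sup>2) \<longlonglongrightarrow> 0"
    by (rule tendsto_sandwich[OF _ _ tendsto_const lim]) (auto intro: always_eventually le simp del: of_real_divide)
  moreover have "filterlim (\<lambda>n. c ^ n / (real n + 2)\<^sup>2) at_top sequentially" if "c > 1" for c :: real
    using that by real_asymp
  note this[OF assms]
  ultimately show False
    using not_tendsto_and_filterlim_at_infinity[OF sequentially_bot]
      filterlim_at_top_imp_at_infinity by blast
qed

definition decay_int :: "complex \<Rightarrow> complex" where
  "decay_int s = (LBINT t:{0..}. exp (- s * of_real t) / of_real ((1 + t)\<^sup>2))"

lemma norm_exp_decay_le:
  fixes s :: complex
  assumes "Re s \<ge> 0" "t \<ge> 0"
  shows "norm (exp (- s * of_real t) / of_real ((1 + t)\<^sup>2)) \<le> 1 / (1 + t)\<^sup>2"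
  using assms by (auto simp: norm_divide norm_power divide_right_mono simp del: of_real_power of_real_add)

lemma set_integrable_exp_decay:
  fixes s :: complex
  assumes "Re s \<ge> 0" "a \<ge> 0"
  shows "set_integrable lborel {a..} (\<lambda>t. exp (- s * of_real t) / of_real ((1 + t)\<^sup>2))"
proof (rule set_integrable_bound[OF set_integrable_inverse_square(1)[OF assms(2)]])
  show "set_borel_measurable lborel {a..} (\<lambda>t. exp (- s * of_real t) / of_real ((1 + t)\<^sup>2))"
    unfolding set_borel_measurable_def by measurable
  show "AE t in lborel. t \<in> {a..} \<longrightarrow>
      norm (exp (- s * of_real t) / of_real ((1 + t)\<^sup>2)) \<le> norm (1 / (1 + t)\<^sup>2)"
    using norm_exp_decay_le[OF assms(1)] assms(2) by auto
qed

lemma eta_sums_decay_int: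
  fixes z :: complex
  assumes "norm z \<le> 1"
  shows "(\<lambda>n. (-1) ^ n * of_real (eta n / fact n) * z ^ n) sums decay_int (z + 1)"
proof -
  define f :: "nat \<Rightarrow> real \<Rightarrow> complex" where
    "f n t = indicator {0..} t *\<^sub>R ((-1) ^ n * z ^ n / fact n * of_real (t ^ n / (1 + t)\<^sup>2 * exp (- t)))" for n t
  have int_real: "set_integrable lborel {0..} (\<lambda>t. complex_of_real (t ^ n / (1 + t)\<^sup>2 * exp (- t)))" for n
    using set_integrable_eta[of n] unfolding set_integrable_def
    by (subst (asm) complex_of_real_integrable_eq[symmetric])
       (simp add: scaleR_conv_of_real)
  have int: "integrable lborel (f n)" for n
    using set_integrable_mult_right[OF int_real] unfolding set_integrable_def f_def by blast
  have integral: "integral\<^sup>L lborel (f n) = (-1) ^ n * of_real (eta n / fact n) * z ^ n" for n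
  proof -
    have "integral\<^sup>L lborel (f n) = (LBINT t:{0..}. (-1) ^ n * z ^ n / fact n * of_real (t ^ n / (1 + t)\<^sup>2 * exp (- t)))"
      unfolding f_def set_lebesgue_integral_def ..
    also have "\<dots> = (-1) ^ n * z ^ n / fact n * of_real (eta n)"
      unfolding eta_def set_integral_complex_of_real[symmetric] by (rule set_integral_mult_right)
    finally show ?thesis by simp
  qed
  have norm_f: "norm (f n t) = norm z ^ n / fact n * (indicator {0..} t *\<^sub>R (t ^ n / (1 + t)\<^sup>2 * exp (- t)))" for n t
    by (auto simp: f_def norm_mult norm_divide norm_power split: split_indicator simp del: of_real_add)
  have sums: "(\<lambda>n. f n t) sums (indicator {0..} t *\<^sub>R (exp (- (z + 1) * of_real t) / of_real ((1 + t)\<^sup>2)))" for t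
  proof -
    have "(\<lambda>n. (- z * of_real t) ^ n /\<^sub>R fact n) sums exp (- z * of_real t)"
      by (rule exp_converges)
    then have "(\<lambda>n. indicator {0..} t *\<^sub>R ((- z * of_real t) ^ n /\<^sub>R fact n * of_real (exp (- t) / (1 + t)\<^sup>2)))
       sums (indicator {0..} t *\<^sub>R (exp (- z * of_real t) * of_real (exp (- t) / (1 + t)\<^sup>2)))"
      by (intro sums_scaleR_right sums_mult2)
    moreover have "(- z * of_real t) ^ n /\<^sub>R fact n * of_real (exp (- t) / (1 + t)\<^sup>2) =
        (-1) ^ n * z ^ n / fact n * of_real (t ^ n / (1 + t)\<^sup>2 * exp (- t))" for n
      by (simp add: power_mult_distrib power_minus[of "z * _"] scaleR_conv_of_real field_simps)
    moreover have "exp (- z * of_real t) * of_real (exp (- t) / (1 + t)\<^sup>2) =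
        exp (- (z + 1) * of_real t) / of_real ((1 + t)\<^sup>2)"
      by (simp add: algebra_simps exp_diff exp_of_real exp_minus divide_simps flip: exp_add)
    ultimately show ?thesis
      by (simp only: f_def)
  qed
  have summable: "summable (\<lambda>n. norm (f n t))" for t
  proof (cases "t \<ge> 0")
    case True
    have "summable (\<lambda>n. (norm z * t) ^ n /\<^sub>R fact n * (exp (- t) / (1 + t)\<^sup>2))"
      by (intro summable_mult2 summable_exp_generic)
    then show ?thesis
      using True by (simp add: norm_f power_mult_distrib divide_inverse mult_ac)
  qed (simp add: f_def)
  have summable_int: "summable (\<lambda>n. \<integral>t. norm (f n t) \<partial>lborel)"
  proof (rule summable_comparison_test[OF _ summable_eta], intro exI allI impI)
    fix n :: nat
    have "(\<integral>t. norm (f n t) \<partial>lborel) = norm z ^ n / fact n * eta n"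
      unfolding norm_f eta_def set_lebesgue_integral_def by (rule integral_mult_right_zero)
    also have "\<dots> \<le> 1 / fact n * eta n"
      using assms eta_nonneg[of n] by (intro mult_right_mono divide_right_mono power_le_one) auto
    finally show "norm (\<integral>t. norm (f n t) \<partial>lborel) \<le> eta n / fact n"
      by simp
  qed
  have "(\<lambda>n. integral\<^sup>L lborel (f n)) sums (\<integral>t. (\<Sum>n. f n t) \<partial>lborel)"
    by (rule sums_integral) (use int summable summable_int in auto)
  moreover have "(\<integral>t. (\<Sum>n. f n t) \<partial>lborel) = decay_int (z + 1)"
    unfolding decay_int_def set_lebesgue_integral_def sums_unique[OF sums, symmetric] ..
  ultimately show ?thesis
    by (simp only: integral)
qed

lemma exp_decay_integral_holomorphic:
  fixes b :: real
  shows "(\<lambda>s. integral {0..b} (\<lambda>t. exp (- s * of_real t) / of_real ((1 + t)\<^sup>2))) holomorphic_on {s. Re s > 0}"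
proof -
  have pos: "1 + complex_of_real t \<noteq> 0" if "t \<ge> 0" for t
    using that by (auto simp: complex_eq_iff)
  have "(\<lambda>s. integral (cbox 0 b) (\<lambda>t. exp (- s * of_real t) / of_real ((1 + t)\<^sup>2))) holomorphic_on {s. Re s > 0}"
  proof (rule leibniz_rule_holomorphic
      [where fx = "\<lambda>s t. - of_real t * exp (- s * of_real t) / of_real ((1 + t)\<^sup>2)"])
    show "((\<lambda>s. exp (- s * of_real t) / of_real ((1 + t)\<^sup>2)) has_field_derivative
        - of_real t * exp (- s * of_real t) / of_real ((1 + t)\<^sup>2)) (at s within {s. Re s > 0})" for s t
      by (rule DERIV_cdivide) (auto intro!: derivative_eq_intros)
    show "(\<lambda>t. exp (- s * of_real t) / of_real ((1 + t)\<^sup>2)) integrable_on cbox 0 b" for s :: complex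
      by (intro integrable_continuous continuous_intros) (use pos in auto)
    show "continuous_on ({s. Re s > 0} \<times> cbox 0 b)
        (\<lambda>(s, t). - of_real t * exp (- s * of_real t) / of_real ((1 + t)\<^sup>2))"
      unfolding case_prod_unfold by (intro continuous_intros) (use pos in auto)
    show "convex {s. Re s > 0}"
      by (rule convex_halfspace_Re_gt)
  qed
  then show ?thesis
    by simp
qed

lemma decay_int_holomorphic: "decay_int holomorphic_on {s. Re s > 0}"
proof -
  define g :: "complex \<Rightarrow> real \<Rightarrow> complex" where
    "g = (\<lambda>s t. exp (- s * of_real t) / of_real ((1 + t)\<^sup>2))"
  define G where "G = (\<lambda>n s. integral {0..real n} (g s))"
  have tail: "norm (G n s - decay_int s) \<le> 1 / (1 + real n)" if "Re s > 0" for n s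
  proof -
    have int: "set_integrable lborel A (g s)" if "A \<subseteq> {0..}" "A \<in> sets lborel" for A
      using set_integrable_subset[OF set_integrable_exp_decay[of s 0] that(2,1)] \<open>Re s > 0\<close>
      unfolding g_def by simp
    have "decay_int s = (LBINT t:{0..real n} \<union> {real n<..}. g s t)"
      unfolding decay_int_def g_def by (simp only: ivl_disj_un_one(7)[of 0 "real n"] of_nat_0_le_iff)
    also have "\<dots> = (LBINT t:{0..real n}. g s t) + (LBINT t:{real n<..}. g s t)"
      by (intro set_integral_Un int) auto
    also have "(LBINT t:{0..real n}. g s t) = G n s"
      unfolding G_def by (intro set_borel_integral_eq_integral int) auto
    finally have "norm (G n s - decay_int s) = norm (LBINT t:{real n<..}. g s t)"
      by simp
    also have "\<dots> \<le> (\<integral>t. norm (indicator {real n<..} t *\<^sub>R g s t) \<partial>lborel)"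
      unfolding set_lebesgue_integral_def by (rule integral_norm_bound)
    also have "\<dots> \<le> (LBINT t:{real n..}. 1 / (1 + t)\<^sup>2)"
      unfolding set_lebesgue_integral_def
    proof (rule integral_mono)
      show "integrable lborel (\<lambda>t. norm (indicator {real n<..} t *\<^sub>R g s t))"
        by (intro integrable_norm int[unfolded set_integrable_def]) auto
      show "integrable lborel (\<lambda>t. indicator {real n..} t *\<^sub>R (1 / (1 + t)\<^sup>2))"
        using set_integrable_inverse_square(1)[of "real n"] by (auto simp: set_integrable_def)
      show "norm (indicator {real n<..} t *\<^sub>R g s t) \<le> indicator {real n..} t *\<^sub>R (1 / (1 + t)\<^sup>2)" for t
        using norm_exp_decay_le[of s t] \<open>Re s > 0\<close> by (auto simp: g_def split: split_indicator)
    qed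
    also have "\<dots> = 1 / (1 + real n)"
      by (simp add: set_integrable_inverse_square)
    finally show ?thesis .
  qed
  show ?thesis
  proof (rule holomorphic_uniform_sequence)
    show open_D: "open {s. Re s > 0}"
      by (rule open_halfspace_Re_gt)
    show "G n holomorphic_on {s. Re s > 0}" for n
      unfolding G_def g_def by (rule exp_decay_integral_holomorphic)
    fix s assume "s \<in> {s. Re s > 0}"
    then obtain d where d: "d > 0" "cball s d \<subseteq> {s. Re s > 0}"
      using open_D open_contains_cball by blast
    have "uniform_limit (cball s d) G decay_int sequentially"
    proof (rule uniform_limitI)
      fix e :: real assume "e > 0"
      have "(\<lambda>n. 1 / (1 + real n)) \<longlonglongrightarrow> 0"
        by real_asymp
      then have "\<forall>\<^sub>F n in sequentially. 1 / (1 + real n) < e"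
        using \<open>e > 0\<close> by (rule order_tendstoD)
      then show "\<forall>\<^sub>F n in sequentially. \<forall>w\<in>cball s d. dist (G n w) (decay_int w) < e"
      proof eventually_elim
        case (elim n)
        show ?case
        proof
          fix w assume "w \<in> cball s d"
          then have "norm (G n w - decay_int w) \<le> 1 / (1 + real n)"
            using d(2) by (intro tail) blast
          with elim show "dist (G n w) (decay_int w) < e"
            by (simp add: dist_norm)
        qed
      qed
    qed
    with d show "\<exists>d>0. cball s d \<subseteq> {s. Re s > 0} \<and> uniform_limit (cball s d) G decay_int sequentially"
      by blast
  qed
qed

lemma set_integrable_exp_Ici:
  fixes x :: real
  assumes "x > 0"
  shows "set_integrable lborel {0..} (\<lambda>t. exp (- x * t))"
proof -
  have "integrable lborel (\<lambda>t. indicator {0..} (0 + x * t) *\<^sub>R (exp (- (0 + x * t))))"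
    using set_integrable_power_times_exp(1)[of 0] assms unfolding set_integrable_def
    by (intro lborel_integrable_real_affine) auto
  moreover have "indicator {0..} (x * t) = (indicator {0..} t :: real)" for t
    using assms by (auto simp: zero_le_mult_iff split: split_indicator)
  ultimately show ?thesis
    unfolding set_integrable_def by simp
qed

lemma decay_int_eq_E1:
  fixes s :: complex
  assumes "Re s > 0"
  shows "decay_int s = 1 - s * exp s * E1 s"
proof -
  define h where "h t = exp (- s * of_real t) / of_real (1 + t)" for t :: real
  define g where "g t = exp (- s * of_real t) / of_real ((1 + t)\<^sup>2)" for t :: real
  define F where "F t = - h t" for t
  have pos: "1 + complex_of_real t \<noteq> 0" if "t \<ge> 0" for t
    using that by (auto simp: complex_eq_iff)
  have norm_h: "norm (h t) \<le> exp (- (Re s * t))" if "t \<ge> 0" for t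
    using that by (simp add: h_def norm_divide divide_le_eq mult_left_mono del: of_real_add)
  have int_h: "set_integrable lborel {0..} h"
  proof (rule set_integrable_bound[OF set_integrable_exp_Ici[OF assms, simplified]])
    show "set_borel_measurable lborel {0..} h"
      unfolding set_borel_measurable_def h_def by measurable
    show "AE t in lborel. t \<in> {0..} \<longrightarrow> norm (h t) \<le> norm (exp (- (Re s * t)))"
      using norm_h by simp
  qed
  have int_g: "set_integrable lborel {0..} g"
    unfolding g_def using assms by (intro set_integrable_exp_decay) auto
  have Ioi: "set_lebesgue_integral lborel {0<..} f = set_lebesgue_integral lborel {0..} f" for f :: "real \<Rightarrow> complex"
    by (rule set_integral_discrete_difference[where X = "{0}"]) auto
  have E1: "exp s * E1 s = (LBINT t:{0..}. h t)"
  proof -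
    have "E1 s = (\<integral>t. indicator {1..} (1 + 1 * t) *\<^sub>R (exp (- s * of_real (1 + 1 * t)) / of_real (1 + 1 * t)) \<partial>lborel)"
      unfolding E1_def set_lebesgue_integral_def
      by (subst lborel_integral_real_affine[where c = 1 and t = 1]) auto
    also have "\<dots> = (LBINT t:{0..}. exp (- s) * h t)"
      unfolding set_lebesgue_integral_def h_def
      by (intro Bochner_Integration.integral_cong refl)
         (auto split: split_indicator simp: algebra_simps exp_diff exp_minus divide_simps exp_add)
    also have "\<dots> = exp (- s) * (LBINT t:{0..}. h t)"
      by (rule set_integral_mult_right)
    finally show ?thesis
      by (simp add: exp_minus)
  qed
  have "(LBINT t=0..\<infinity>. s * h t + g t) = 0 - F 0"
  proof (rule interval_integral_FTC_integrable)
    fix t :: real assume "0 < ereal t"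
    then have t: "1 + complex_of_real t \<noteq> 0"
      using pos[of t] by simp
    define e where "e = exp (- s * of_real t)"
    have "((\<lambda>w. - (exp (- s * w) / (1 + w))) has_field_derivative
        - (((- s * e) * (1 + of_real t) - e * 1) / ((1 + of_real t) * (1 + of_real t)))) (at (of_real t))"
      using t unfolding e_def by (auto intro!: derivative_eq_intros)
    also have "- (((- s * e) * (1 + of_real t) - e * 1) / ((1 + of_real t) * (1 + of_real t))) = s * h t + g t"
      using t unfolding h_def g_def e_def[symmetric] of_real_power of_real_add of_real_1 power2_eq_square
      by (simp add: add_divide_distrib diff_divide_distrib)
    finally have "((\<lambda>t. - (exp (- s * of_real t) / (1 + of_real t))) has_vector_derivative (s * h t + g t)) (at t)"
      by (rule has_vector_derivative_real_field)
    then show "(F has_vector_derivative (s * h t + g t)) (at t)"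
      by (simp only: F_def[abs_def] h_def of_real_add of_real_1)
    show "isCont (\<lambda>t. s * h t + g t) t"
      unfolding h_def g_def using t by (intro continuous_intros) auto
  next
    show "set_integrable lborel (einterval 0 \<infinity>) (\<lambda>t. s * h t + g t)"
      by (rule set_integrable_subset[of _ "{0..}"])
         (use int_h int_g in \<open>auto simp: einterval_def\<close>)
    have "isCont F 0"
      unfolding F_def h_def by (intro continuous_intros) auto
    then have "(F \<longlongrightarrow> F 0) (at_right 0)"
      by (simp add: isCont_def filterlim_at_split)
    then show "((F \<circ> real_of_ereal) \<longlongrightarrow> F 0) (at_right 0)"
      by (simp add: zero_ereal_def ereal_tendsto_simps)
    have "(F \<longlongrightarrow> 0) at_top"
    proof (rule Lim_null_comparison)
      show "\<forall>\<^sub>F t in at_top. norm (F t) \<le> exp (- (Re s * t))"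
        using eventually_ge_at_top[of 0] by eventually_elim (auto simp: F_def intro: norm_h)
      show "((\<lambda>t. exp (- (Re s * t))) \<longlongrightarrow> 0) at_top"
        using assms by real_asymp
    qed
    then show "((F \<circ> real_of_ereal) \<longlongrightarrow> 0) (at_left \<infinity>)"
      by (simp add: ereal_tendsto_simps)
  qed auto
  then have "1 = (LBINT t:{0..}. s * h t + g t)"
    by (simp add: interval_lebesgue_integral_0_infty Ioi F_def h_def)
  also have "\<dots> = s * (LBINT t:{0..}. h t) + decay_int s"
    using int_h int_g unfolding decay_int_def g_def[symmetric]
    by (simp only: set_integral_add set_integrable_mult_right set_integral_mult_right)
  finally show ?thesis
    by (simp add: E1[symmetric] algebra_simps)
qed

theorem theorem3p13:
  fixes z :: complex
  assumes "Re z > -1"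
  shows "(summable (\<lambda>n. (-1) ^ n * of_real (eta n / fact n) * z ^ n) \<longleftrightarrow> norm z \<le> 1) \<and>
         (norm z \<le> 1 \<longrightarrow>
           (\<lambda>n. (-1) ^ n * of_real (eta n / fact n) * z ^ n) sums
             (1 - (z + 1) * exp (z + 1) * E1 (z + 1))) \<and>
         has_continued_sum (\<lambda>n. (-1) ^ n * of_real (eta n / fact n)) {w. Re w > -1} z
           (1 - (z + 1) * exp (z + 1) * E1 (z + 1))"
proof (intro conjI impI)
  have eq: "decay_int (z + 1) = 1 - (z + 1) * exp (z + 1) * E1 (z + 1)"
    using assms by (intro decay_int_eq_E1) auto
  show "summable (\<lambda>n. (-1) ^ n * of_real (eta n / fact n) * z ^ n) \<longleftrightarrow> norm z \<le> 1"
    using not_summable_eta_power eta_sums_decay_int sums_summable not_le by metis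
  show "(\<lambda>n. (-1) ^ n * of_real (eta n / fact n) * z ^ n) sums (1 - (z + 1) * exp (z + 1) * E1 (z + 1))"
    if "norm z \<le> 1"
    using eta_sums_decay_int[OF that] eq by simp
  have "(\<lambda>w. decay_int (w + 1)) holomorphic_on {w. Re w > -1}"
    by (rule holomorphic_on_compose_gen[of "\<lambda>w. w + 1", OF _ decay_int_holomorphic, unfolded comp_def])
       (auto intro!: holomorphic_intros)
  moreover have "\<forall>\<^sub>F w in nhds 0. (\<lambda>n. (-1) ^ n * of_real (eta n / fact n) * w ^ n) sums decay_int (w + 1)"
    using eventually_nhds_ball[OF zero_less_one, of 0]
  proof (rule eventually_mono)
    fix w :: complex assume "w \<in> ball 0 1"
    then show "(\<lambda>n. (-1) ^ n * of_real (eta n / fact n) * w ^ n) sums decay_int (w + 1)"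
      by (intro eta_sums_decay_int) simp
  qed
  ultimately show "has_continued_sum (\<lambda>n. (-1) ^ n * of_real (eta n / fact n)) {w. Re w > -1} z
      (1 - (z + 1) * exp (z + 1) * E1 (z + 1))"
    unfolding has_continued_sum_def using assms eq
    by (auto intro!: open_halfspace_Re_gt convex_connected convex_halfspace_Re_gt
        exI[of _ "\<lambda>w. decay_int (w + 1)"])
qed

end
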